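(* Let $n\in\mathbb{N}_0$ and $i=\sqrt{-1}$. Then $${}_{T}B_{n}^{(v)}(x+iz,y;\lambda)={}_{T}B_{n}^{(c,v)}(x,y,z;\lambda)+i\,{}_{T}B_{n}^{(s,v)}(x,y,z;\lambda).$$
   Context: $\mathbb{N}_0=\{0,1,2,\dots\}$; $x,y,z$ are variables (taking complex values) and $\lambda\in\mathbb{C}\setminus\{0\}$. Let $\mathcal{U}(y,t)=\sum_{n\ge0}\mathcal{U}_n(y)\frac{t^n}{n!}$ be a power series in $t$ with coefficients depending on $y$ and $\mathcal{U}_0(y)\neq0$; the 2-variable general polynomials $T_n(x,y)$ are defined by $e^{xt}\mathcal{U}(y,t)=\sum_{n\ge0}T_n(x,y)\frac{t^n}{n!}$, with the normalization $T_0(x,y)=1$. The order $v$ is such that $\bigl(\frac{t}{\lambda e^t-1}\bigr)^v$ is a power series in $t$ ($v\in\mathbb{N}_0$ in general; $v\in\mathbb{C}$ allowed when $\lambda=1$, with the branch $1^v=1$ at $t=0$). The parametric kinds of generalized Apostol--Bernoulli polynomials are defined, as power series in $t$, by $$\Bigl(\frac{t}{\lambda e^t-1}\Bigr)^v e^{xt}\,\mathcal{U}(y,t)\cos(zt)=\sum_{n=0}^\infty {}_{T}B_{n}^{(c,v)}(x,y,z;\lambda)\frac{t^n}{n!},$$ $$\Bigl(\frac{t}{\lambda e^t-1}\Bigr)^v e^{xt}\,\mathcal{U}(y,t)\sin(zt)=\sum_{n=0}^\infty {}_{T}B_{n}^{(s,v)}(x,y,z;\lambda)\frac{t^n}{n!}.$$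 The polynomials ${}_{T}B_{n}^{(v)}(x,y;\lambda)$ are the case $z=0$ of the cosine kind, ${}_{T}B_{n}^{(v)}(x,y;\lambda)={}_{T}B_{n}^{(c,v)}(x,y,0;\lambda)$, i.e. $\bigl(\frac{t}{\lambda e^t-1}\bigr)^v e^{xt}\,\mathcal{U}(y,t)=\sum_{n\ge0}{}_{T}B_{n}^{(v)}(x,y;\lambda)\frac{t^n}{n!}$. *)

theory Defs
  imports Complex_Main "HOL-Computational_Algebra.Formal_Power_Series"
begin

(* All generating functions are formal power series in t = fps_X over the complex numbers. *)

(* f n is the coefficient of t^n / n! in egf f; conversely egf_coeff F n is that coefficient of F *)
definition egf :: "(nat \<Rightarrow> complex) \<Rightarrow> complex fps" where
  "egf f = Abs_fps (\<lambda>n. f n / fact n)"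

definition egf_coeff :: "complex fps \<Rightarrow> nat \<Rightarrow> complex" where
  "egf_coeff F n = fact n * fps_nth F n"

lemma egf_egf_coeff: "egf (egf_coeff F) = F"
  by (simp add: egf_def egf_coeff_def fps_eq_iff)

lemma egf_coeff_egf: "egf_coeff (egf f) = f"
  by (simp add: egf_def egf_coeff_def fun_eq_iff)

(* U n y is the coefficient U_n(y); general_poly U n x y is T_n(x, y) *)
definition general_poly :: "(nat \<Rightarrow> complex \<Rightarrow> complex) \<Rightarrow> nat \<Rightarrow> complex \<Rightarrow> complex \<Rightarrow> complex" where
  "general_poly U n x y = egf_coeff (fps_exp x * egf (\<lambda>k. U k y)) n"

(* The power F^v for a complex exponent v: the ordinary power if v is a natural number, and
   otherwise the binomial series (1 + (F - 1))^v, which is the branch with 1^v = 1 at t = 0.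
   The second case is meaningful only if F has constant term 1; then the two cases agree
   wherever both apply (fps_cpow_eq_binomial). *)
definition fps_cpow :: "complex fps \<Rightarrow> complex \<Rightarrow> complex fps" where
  "fps_cpow F v =
     (if v \<in> \<nat> then F ^ (THE k. v = of_nat k) else fps_compose (fps_binomial v) (F - 1))"

lemma fps_cpow_of_nat: "fps_cpow F (of_nat k) = F ^ k"
proof -
  have "(THE j. (of_nat k :: complex) = of_nat j) = k" by (rule the_equality) auto
  then show ?thesis by (simp add: fps_cpow_def)
qed

lemma fps_cpow_eq_binomial:
  assumes "fps_nth F 0 = 1"
  shows "fps_cpow F v = fps_compose (fps_binomial v) (F - 1)"
proof (cases "v \<in> \<nat>")
  case True
  then obtain k where k: "v = of_nat k" by (auto elim: Nats_cases)
  have "fps_compose ((1 + fps_X) ^ k) (F - 1) = fps_compose (1 + fps_X) (F - 1) ^ k"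
    using assms by (intro fps_compose_power [symmetric]) simp
  also have "fps_compose (1 + fps_X) (F - 1) = F"
    using assms by (simp add: fps_compose_add_distrib)
  finally show ?thesis by (simp add: k fps_cpow_of_nat fps_binomial_of_nat)
qed (simp add: fps_cpow_def)

definition apostol_base :: "complex \<Rightarrow> complex fps" where
  "apostol_base l = fps_X / (fps_const l * fps_exp 1 - 1)"

(* For l = 1 the divisor has constant term 0, but the division is still exact. *)
lemma apostol_base_mult: "apostol_base l * (fps_const l * fps_exp 1 - 1) = fps_X"
proof (cases "l = 1")
  case True
  have "subdegree (fps_exp 1 - 1 :: complex fps) = 1"
    by (rule subdegreeI) auto
  then have "(fps_exp 1 - 1 :: complex fps) dvd fps_X"
    by (subst fps_dvd_iff) auto
  then show ?thesis using True by (simp add: apostol_base_def)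
next
  case False
  then have "is_unit (fps_const l * fps_exp 1 - 1 :: complex fps)"
    by (simp add: fps_is_unit_iff)
  then have "(fps_const l * fps_exp 1 - 1 :: complex fps) dvd fps_X"
    by (rule unit_imp_dvd)
  then show ?thesis by (simp add: apostol_base_def)
qed

lemma apostol_base_1_nth_0: "fps_nth (apostol_base 1) 0 = 1"
proof -
  have "fps_nth (apostol_base 1 * (fps_exp 1 - 1)) 1 = 1"
    using apostol_base_mult[of 1] by simp
  then show ?thesis by (simp add: fps_mult_nth)
qed

definition apostol_bern_c ::
    "(nat \<Rightarrow> complex \<Rightarrow> complex) \<Rightarrow> complex \<Rightarrow> nat \<Rightarrow> complex \<Rightarrow> complex \<Rightarrow> complex \<Rightarrow> complex \<Rightarrow> complex"
  where "apostol_bern_c U v n x y z l =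
    egf_coeff (fps_cpow (apostol_base l) v * fps_exp x * egf (\<lambda>k. U k y) * fps_cos z) n"

definition apostol_bern_s ::
    "(nat \<Rightarrow> complex \<Rightarrow> complex) \<Rightarrow> complex \<Rightarrow> nat \<Rightarrow> complex \<Rightarrow> complex \<Rightarrow> complex \<Rightarrow> complex \<Rightarrow> complex"
  where "apostol_bern_s U v n x y z l =
    egf_coeff (fps_cpow (apostol_base l) v * fps_exp x * egf (\<lambda>k. U k y) * fps_sin z) n"

definition apostol_bern ::
    "(nat \<Rightarrow> complex \<Rightarrow> complex) \<Rightarrow> complex \<Rightarrow> nat \<Rightarrow> complex \<Rightarrow> complex \<Rightarrow> complex \<Rightarrow> complex"
  where "apostol_bern U v n x y l = apostol_bern_c U v n x y 0 l"

end

theory Submission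
  imports Defs
begin

text \<open>Shifting x by \<i> * z multiplies the generating function by e^(izt), which Euler's
  formula for formal power series (\<open>fps_exp_ii_sin_cos\<close>) splits into cos(zt) + i
  sin(zt). Comparing coefficients gives the claim.\<close>

theorem theorem3p7:
  fixes U :: "nat \<Rightarrow> complex \<Rightarrow> complex" and v l x y z :: complex and n :: nat
  assumes "l \<noteq> 0"
    and "\<And>y. U 0 y \<noteq> 0"
    and "\<And>x y. general_poly U 0 x y = 1"
    and "v \<in> \<nat> \<or> l = 1"
  shows "apostol_bern U v n (x + \<i> * z) y l =
           apostol_bern_c U v n x y z l + \<i> * apostol_bern_s U v n x y z l"
proof -
  define A where "A = fps_cpow (apostol_base l) v * fps_exp x * egf (\<lambda>k. U k y)"
  have "fps_exp (\<i> * z) = fps_cos z + fps_const \<i> * fps_sin z"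
    using fps_exp_ii_sin_cos[of z] by simp
  \<comment> \<open>The factor \<open>fps_cos 0\<close>, equal to 1, is kept to match
    \<open>apostol_bern\<close>, the cosine kind at z = 0.\<close>
  then have "fps_cpow (apostol_base l) v * fps_exp (x + \<i> * z) * egf (\<lambda>k. U k y) * fps_cos 0 =
      A * fps_cos z + fps_const \<i> * (A * fps_sin z)"
    by (simp add: A_def fps_exp_add_mult algebra_simps)
  \<comment> \<open>\<open>egf_coeff\<close> is linear, so the constant \<i> comes out of the
    coefficient.\<close>
  then show ?thesis
    by (simp add: apostol_bern_def apostol_bern_c_def apostol_bern_s_def egf_coeff_def A_def
        distrib_left)
qed

end
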